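(* Let $k$ be an even integer and $t$ an even integer with $0<t<k$. Let $\mathcal{H}$ be a $k$-uniform hypergraph with $n$ vertices and $m\geq 1$ edges, and let $\delta$ be the minimum degree of $\mathcal{H}$. Then there exists a signed adjacency tensor $\mathcal{A}\in\mathcal{S}(\mathcal{H})$ such that \[ \alpha_t(\mathcal{H}) \leq \frac{t\,(km-n\lambda)\,(-\lambda)^{\frac{t}{k-t}}}{(k-t)\,\delta^{\frac{k}{k-t}}+(k\delta-t\lambda)\,(-\lambda)^{\frac{t}{k-t}}}, \] where $\lambda$ is the minimum $H$-eigenvalue of $\mathcal{A}$.
   Context: A hypergraph $\mathcal{H}$ is $k$-uniform if every edge consists of exactly $k$ distinct vertices; the degree of a vertex is the number of edges containing it. For $0<t<k$, a set $S\subseteq V(\mathcal{H})$ is a $t$-independent set if $|e\cap S|\in\{0,t\}$ for every edge $e$; $\alpha_t(\mathcal{H})$ is the maximum size of a $t$-independent set. A real order-$k$, dimension-$n$ tensor $\mathcal{A}=(a_{i_1\cdots i_k})$ is a signed adjacency tensor of $\mathcal{H}$ if $|a_{i_1\cdots i_k}|=\frac{1}{(k-1)!}$ when $\{i_1,\dots,i_k\}\in E(\mathcal{H})$ and $a_{i_1\cdots i_k}=0$ otherwise; $\mathcal{S}(\mathcal{H})$ is the set of these. For a tensor $\mathcal{A}$ and $x\in\mathbb{C}^n$, $(\mathcal{A}x^{k-1})_i=\sum_{i_2,\dots,i_k}a_{i i_2\cdots i_k}x_{i_2}\cdots x_{i_k}$; $\lambda$ is an eigenvalue with eigenvector $x\neq0$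 if $\mathcal{A}x^{k-1}=\lambda x^{[k-1]}$, $x^{[k-1]}=(x_1^{k-1},\dots,x_n^{k-1})^\top$; it is an $H$-eigenvalue if $\lambda$ is real with a real eigenvector. *)

theory Defs
  imports Complex_Main
begin

definition hypergraph :: "'v set \<Rightarrow> 'v set set \<Rightarrow> bool" where
  "hypergraph V E \<longleftrightarrow> finite V \<and> (\<forall>e\<in>E. e \<subseteq> V)"

definition uniform_hypergraph :: "nat \<Rightarrow> 'v set \<Rightarrow> 'v set set \<Rightarrow> bool" where
  "uniform_hypergraph k V E \<longleftrightarrow> hypergraph V E \<and> (\<forall>e\<in>E. card e = k)"

definition vertex_degree :: "'v set set \<Rightarrow> 'v \<Rightarrow> nat" where
  "vertex_degree E v = card {e\<in>E. v \<in> e}"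

definition min_degree :: "'v set \<Rightarrow> 'v set set \<Rightarrow> nat" where
  "min_degree V E = Min (vertex_degree E ` V)"

definition t_independent :: "nat \<Rightarrow> 'v set \<Rightarrow> 'v set set \<Rightarrow> 'v set \<Rightarrow> bool" where
  "t_independent t V E S \<longleftrightarrow> S \<subseteq> V \<and> (\<forall>e\<in>E. card (e \<inter> S) \<in> {0, t})"

definition t_independence_number :: "nat \<Rightarrow> 'v set \<Rightarrow> 'v set set \<Rightarrow> nat" where
  "t_independence_number t V E = Max (card ` {S. t_independent t V E S})"

text \<open>
  A tensor of order \<open>k\<close> and dimension \<open>card V\<close> is indexed by the lists of length \<open>k\<close> over the
  finite set \<open>V\<close>; a vector is indexed by \<open>V\<close>. Values at other arguments play no role.
\<close>

type_synonym 'v tensor = "'v list \<Rightarrow> real"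

definition tensor_indices :: "nat \<Rightarrow> 'v set \<Rightarrow> 'v list set" where
  "tensor_indices k V = {vs. set vs \<subseteq> V \<and> length vs = k}"

definition tensor_apply :: "nat \<Rightarrow> 'v set \<Rightarrow> 'v tensor \<Rightarrow> ('v \<Rightarrow> complex) \<Rightarrow> 'v \<Rightarrow> complex" where
  "tensor_apply k V A x v =
     (\<Sum>vs\<in>tensor_indices (k - 1) V. complex_of_real (A (v # vs)) * prod_list (map x vs))"

definition eigenpair ::
    "nat \<Rightarrow> 'v set \<Rightarrow> 'v tensor \<Rightarrow> complex \<Rightarrow> ('v \<Rightarrow> complex) \<Rightarrow> bool" where
  "eigenpair k V A l x \<longleftrightarrow>
     (\<exists>v\<in>V. x v \<noteq> 0) \<and> (\<forall>v\<in>V. tensor_apply k V A x v = l * x v ^ (k - 1))"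

definition H_eigenvalue :: "nat \<Rightarrow> 'v set \<Rightarrow> 'v tensor \<Rightarrow> real \<Rightarrow> bool" where
  "H_eigenvalue k V A l \<longleftrightarrow>
     (\<exists>x :: 'v \<Rightarrow> real. eigenpair k V A (complex_of_real l) (\<lambda>v. complex_of_real (x v)))"

definition min_H_eigenvalue :: "nat \<Rightarrow> 'v set \<Rightarrow> 'v tensor \<Rightarrow> real \<Rightarrow> bool" where
  "min_H_eigenvalue k V A l \<longleftrightarrow>
     H_eigenvalue k V A l \<and> (\<forall>l'. H_eigenvalue k V A l' \<longrightarrow> l \<le> l')"

text \<open>
  The signs of the nonzero entries are arbitrary; in particular symmetry is not required.
\<close>

definition signed_adjacency_tensors :: "nat \<Rightarrow> 'v set \<Rightarrow> 'v set set \<Rightarrow> 'v tensor set" where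
  "signed_adjacency_tensors k V E =
     {A. \<forall>vs\<in>tensor_indices k V.
           (set vs \<in> E \<longrightarrow> \<bar>A vs\<bar> = 1 / fact (k - 1)) \<and> (set vs \<notin> E \<longrightarrow> A vs = 0)}"

end

theory Submission
  imports Defs "HOL-Analysis.Analysis" "HOL-Combinatorics.Multiset_Permutations"
begin

text \<open>
  Take a maximum \<open>t\<close>-independent set \<open>S\<close> and the symmetric tensor with sign \<open>-1\<close> on the edges
  meeting \<open>S\<close> and \<open>+1\<close> on the others. Since \<open>k\<close> is even, the minimum \<open>H\<close>-eigenvalue \<open>\<mu>\<close> of a
  symmetric tensor is the minimum of its form on the sphere \<open>\<Sum>v\<in>V. x v ^ k = 1\<close>, and \<open>\<mu> < 0\<close>
  because every monomial of the form is square-free. Evaluating the form at the vector with value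
  \<open>s\<close> on \<open>S\<close> and \<open>1\<close> elsewhere, and bounding the number of edges meeting \<open>S\<close> below by
  \<open>\<delta> * card S / t\<close>, gives an upper bound on \<open>card S\<close> for every \<open>s \<ge> 0\<close>; the best choice is
  \<open>s ^ (k - t) = \<delta> / (- \<mu>)\<close>.
\<close>

section \<open>Signed tensors and the polynomials they define\<close>

text \<open>The sign depends only on the set of indices, so the tensor is symmetric and amounts to
  one sign per edge.\<close>

definition signed_tensor :: "nat \<Rightarrow> 'v set set \<Rightarrow> ('v set \<Rightarrow> real) \<Rightarrow> 'v tensor" where
  "signed_tensor k E \<sigma> vs = (if set vs \<in> E then \<sigma> (set vs) / fact (k - 1) else 0)"

definition signed_form :: "'v set set \<Rightarrow> ('v set \<Rightarrow> real) \<Rightarrow> ('v \<Rightarrow> real) \<Rightarrow> real" where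
  "signed_form E \<sigma> x = (\<Sum>e\<in>E. \<sigma> e * (\<Prod>u\<in>e. x u))"

text \<open>This is the partial derivative of \<open>signed_form\<close> with respect to the
  coordinate at \<open>v\<close>.\<close>

definition signed_link_form ::
    "'v set set \<Rightarrow> ('v set \<Rightarrow> real) \<Rightarrow> ('v \<Rightarrow> real) \<Rightarrow> 'v \<Rightarrow> real" where
  "signed_link_form E \<sigma> x v = (\<Sum>e\<in>{e\<in>E. v \<in> e}. \<sigma> e * (\<Prod>u\<in>e - {v}. x u))"

lemma uniform_hypergraphD:
  assumes "uniform_hypergraph k V E"
  shows "finite V" "finite E" "\<And>e. e \<in> E \<Longrightarrow> e \<subseteq> V" "\<And>e. e \<in> E \<Longrightarrow> finite e" "\<And>e. e \<in> E \<Longrightarrow> card e = k"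
proof -
  show fV: "finite V" using assms by (auto simp: uniform_hypergraph_def hypergraph_def)
  show sub: "e \<subseteq> V" if "e \<in> E" for e
    using assms that by (auto simp: uniform_hypergraph_def hypergraph_def)
  show "finite E" using fV sub by (meson Pow_iff finite_Pow_iff finite_subset subsetI)
  show "finite e" if "e \<in> E" for e using fV sub[OF that] finite_subset by blast
  show "card e = k" if "e \<in> E" for e
    using assms that by (auto simp: uniform_hypergraph_def)
qed

lemma signed_tensor_mem:
  assumes "\<And>e. e \<in> E \<Longrightarrow> \<bar>\<sigma> e\<bar> = 1"
  shows "signed_tensor k E \<sigma> \<in> signed_adjacency_tensors k V E"
  using assms by (auto simp: signed_adjacency_tensors_def signed_tensor_def)

text \<open>An edge has \<open>k\<close> vertices, so \<open>k - 1\<close> further entries can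
  complete \<open>v\<close> to \<open>e\<close> only if none of them is repeated or equal to
  \<open>v\<close>. Each edge through \<open>v\<close> thus accounts for exactly
  \<open>fact (k - 1)\<close> index lists.\<close>

lemma lists_completing_edge:
  assumes "uniform_hypergraph k V E" "e \<in> E" "v \<in> e"
  shows "{vs \<in> tensor_indices (k - 1) V. set (v # vs) = e} = permutations_of_set (e - {v})"
proof -
  note H = uniform_hypergraphD[OF assms(1)]
  have fin: "finite e" and card: "card (e - {v}) = k - 1" "card e = k" and "e \<subseteq> V"
    using H(3-5)[OF assms(2)] assms(3) by auto
  have "k > 0" using card fin assms(3) by (auto simp: card_gt_0_iff)
  have "set vs = e - {v} \<and> distinct vs" if "length vs = k - 1" "insert v (set vs) = e" for vs
  proof -
    have "card (set vs) \<le> k - 1" using card_length[of vs] that by simp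
    then have "v \<notin> set vs"
      using that card \<open>k > 0\<close> by (metis diff_less insert_absorb leD less_numeral_extra(1))
    then have "set vs = e - {v}" using that by auto
    then show ?thesis using card that by (simp add: card_distinct)
  qed
  moreover have "length vs = k - 1" if "set vs = e - {v}" "distinct vs" for vs
    using that card by (metis distinct_card)
  moreover have "set vs \<subseteq> V" "insert v (set vs) = e" if "set vs = e - {v}" for vs
    using that \<open>e \<subseteq> V\<close> assms(3) by auto
  ultimately have "set vs \<subseteq> V \<and> length vs = k - 1 \<and> insert v (set vs) = e \<longleftrightarrow>
      set vs = e - {v} \<and> distinct vs" for vs
    by metis
  then show ?thesis
    by (simp add: tensor_indices_def permutations_of_set_def conj_assoc)
qed

text \<open>Group the index lists by the edge they complete with \<open>v\<close>. The
  \<open>fact (k - 1)\<close> orderings of \<open>e - {v}\<close> contribute equally and cancel the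
  normalisation of the entries.\<close>

lemma tensor_apply_signed_tensor:
  assumes "uniform_hypergraph k V E"
  shows "tensor_apply k V (signed_tensor k E \<sigma>) (\<lambda>u. complex_of_real (x u)) v =
    complex_of_real (signed_link_form E \<sigma> x v)"
proof -
  note H = uniform_hypergraphD[OF assms(1)]
  let ?I = "tensor_indices (k - 1) V"
  let ?E = "{e\<in>E. v \<in> e}"
  have finI: "finite ?I"
    using finite_lists_length_eq[OF H(1)] by (simp add: tensor_indices_def)
  let ?g = "\<lambda>vs. signed_tensor k E \<sigma> (v # vs) * prod_list (map x vs)"
  have "tensor_apply k V (signed_tensor k E \<sigma>) (\<lambda>u. complex_of_real (x u)) v =
      complex_of_real (\<Sum>vs\<in>?I. ?g vs)"
  proof -
    have "prod_list (map (\<lambda>u. complex_of_real (x u)) vs) = complex_of_real (prod_list (map x vs))" for vs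
      by (induction vs) auto
    then show ?thesis by (simp add: tensor_apply_def)
  qed
  also have "(\<Sum>vs\<in>?I. ?g vs) = (\<Sum>vs\<in>{vs\<in>?I. set (v # vs) \<in> ?E}. ?g vs)"
    by (rule sum.mono_neutral_right[OF finI]) (auto simp: signed_tensor_def)
  also have "\<dots> = (\<Sum>e\<in>?E. \<Sum>vs\<in>{vs\<in>{vs\<in>?I. set (v # vs) \<in> ?E}. set (v # vs) = e}. ?g vs)"
    by (rule sum.group[symmetric]) (use finI in simp, use H(2) in auto)
  also have "\<dots> = (\<Sum>e\<in>?E. \<sigma> e * (\<Prod>u\<in>e - {v}. x u))"
  proof (rule sum.cong[OF refl])
    fix e assume e: "e \<in> ?E"
    have "{vs\<in>{vs\<in>?I. set (v # vs) \<in> ?E}. set (v # vs) = e} = permutations_of_set (e - {v})"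
      using lists_completing_edge[OF assms, of e v] e by auto
    moreover have "?g vs = \<sigma> e / fact (k - 1) * (\<Prod>u\<in>e - {v}. x u)"
      if "vs \<in> permutations_of_set (e - {v})" for vs
    proof -
      have "set vs = e - {v}" "distinct vs" using that by (auto simp: permutations_of_set_def)
      moreover have "set (v # vs) = e" using calculation e by auto
      ultimately show ?thesis
        using e by (simp add: signed_tensor_def flip: prod.distinct_set_conv_list)
    qed
    moreover have "card (permutations_of_set (e - {v})) = fact (k - 1)"
      using e H(4,5)[of e] by (simp add: card_Diff_singleton)
    ultimately show "(\<Sum>vs\<in>{vs\<in>{vs\<in>?I. set (v # vs) \<in> ?E}. set (v # vs) = e}. ?g vs) =
        \<sigma> e * (\<Prod>u\<in>e - {v}. x u)"
      by simp
  qed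
  finally show ?thesis by (simp add: signed_link_form_def)
qed

lemma H_eigenvalue_signed_tensor:
  assumes "uniform_hypergraph k V E"
  shows "H_eigenvalue k V (signed_tensor k E \<sigma>) l \<longleftrightarrow>
    (\<exists>x. (\<exists>v\<in>V. x v \<noteq> 0) \<and> (\<forall>v\<in>V. signed_link_form E \<sigma> x v = l * x v ^ (k - 1)))"
proof -
  have "complex_of_real a = complex_of_real l * complex_of_real b ^ (k - 1) \<longleftrightarrow>
      a = l * b ^ (k - 1)" for a b
    by (metis of_real_eq_iff of_real_mult of_real_power)
  then show ?thesis
    by (simp add: H_eigenvalue_def eigenpair_def tensor_apply_signed_tensor[OF assms])
qed

section \<open>Algebra of the signed form\<close>

lemma sum_incidence_swap:
  fixes f :: "'v \<Rightarrow> 'v set \<Rightarrow> real"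
  assumes "finite S" "finite E"
  shows "(\<Sum>v\<in>S. \<Sum>e\<in>{e\<in>E. v \<in> e}. f v e) = (\<Sum>e\<in>E. \<Sum>v\<in>e \<inter> S. f v e)"
proof -
  have "(\<Sum>v\<in>S. \<Sum>e\<in>{e\<in>E. v \<in> e}. f v e) = (\<Sum>e\<in>E. \<Sum>v\<in>{v\<in>S. v \<in> e}. f v e)"
    by (rule sum.swap_restrict) (use assms in auto)
  moreover have "{v\<in>S. v \<in> e} = e \<inter> S" for e by auto
  ultimately show ?thesis by simp
qed

text \<open>Euler's identity for a form of degree \<open>k\<close>: the monomial of an edge is
  counted once for each of its \<open>k\<close> vertices. It converts the eigenvalue equations into
  a value of the form.\<close>

lemma signed_form_Euler:
  assumes "uniform_hypergraph k V E"
  shows "(\<Sum>v\<in>V. x v * signed_link_form E \<sigma> x v) = real k * signed_form E \<sigma> x"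
proof -
  note H = uniform_hypergraphD[OF assms(1)]
  have "(\<Sum>v\<in>V. x v * signed_link_form E \<sigma> x v) =
      (\<Sum>v\<in>V. \<Sum>e\<in>{e\<in>E. v \<in> e}. \<sigma> e * (\<Prod>u\<in>e. x u))"
    unfolding signed_link_form_def sum_distrib_left
  proof (intro sum.cong refl)
    fix v e assume "e \<in> {e\<in>E. v \<in> e}"
    then show "x v * (\<sigma> e * (\<Prod>u\<in>e - {v}. x u)) = \<sigma> e * (\<Prod>u\<in>e. x u)"
      using prod.remove[of e v x] H(4)[of e] by simp
  qed
  also have "\<dots> = (\<Sum>e\<in>E. \<Sum>v\<in>e \<inter> V. \<sigma> e * (\<Prod>u\<in>e. x u))"
    by (rule sum_incidence_swap[OF H(1,2)])
  also have "\<dots> = (\<Sum>e\<in>E. real k * (\<sigma> e * (\<Prod>u\<in>e. x u)))"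
    by (intro sum.cong refl) (use H(3,5) in \<open>auto simp: Int_absorb2\<close>)
  finally show ?thesis by (simp add: signed_form_def sum_distrib_left)
qed

lemma signed_form_scale:
  assumes "uniform_hypergraph k V E"
  shows "signed_form E \<sigma> (\<lambda>v. c * x v) = c ^ k * signed_form E \<sigma> x"
  using uniform_hypergraphD(5)[OF assms]
  by (auto simp: signed_form_def prod.distrib sum_distrib_left intro!: sum.cong)

lemma signed_form_cong:
  assumes "uniform_hypergraph k V E" "\<And>v. v \<in> V \<Longrightarrow> x v = y v"
  shows "signed_form E \<sigma> x = signed_form E \<sigma> y"
proof -
  have "(\<Prod>u\<in>e. x u) = (\<Prod>u\<in>e. y u)" if "e \<in> E" for e
    using uniform_hypergraphD(3)[OF assms(1) that] assms(2) by (intro prod.cong) auto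
  then show ?thesis by (simp add: signed_form_def)
qed

text \<open>No monomial contains a variable twice, so the form is affine in each single coordinate,
  with the link form as slope.\<close>

lemma signed_form_update:
  assumes "uniform_hypergraph k V E"
  shows "signed_form E \<sigma> (x(v := r)) =
    r * signed_link_form E \<sigma> x v + (\<Sum>e\<in>{e\<in>E. v \<notin> e}. \<sigma> e * (\<Prod>u\<in>e. x u))"
proof -
  note H = uniform_hypergraphD[OF assms(1)]
  let ?f = "\<lambda>e. \<sigma> e * (\<Prod>u\<in>e. (x(v := r)) u)"
  have "E = {e\<in>E. v \<in> e} \<union> {e\<in>E. v \<notin> e}" by auto
  then have "signed_form E \<sigma> (x(v := r)) = sum ?f ({e\<in>E. v \<in> e} \<union> {e\<in>E. v \<notin> e})"
    by (simp add: signed_form_def)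
  also have "\<dots> = sum ?f {e\<in>E. v \<in> e} + sum ?f {e\<in>E. v \<notin> e}"
    by (rule sum.union_disjoint) (use H(2) in auto)
  also have "sum ?f {e\<in>E. v \<in> e} = r * signed_link_form E \<sigma> x v"
    unfolding signed_link_form_def sum_distrib_left
  proof (intro sum.cong refl)
    fix e assume e: "e \<in> {e\<in>E. v \<in> e}"
    have "(\<Prod>u\<in>e. (x(v := r)) u) = r * (\<Prod>u\<in>e - {v}. (x(v := r)) u)"
      using prod.remove[of e v "x(v := r)"] H(4)[of e] e by simp
    also have "(\<Prod>u\<in>e - {v}. (x(v := r)) u) = (\<Prod>u\<in>e - {v}. x u)"
      by (intro prod.cong) auto
    finally show "?f e = r * (\<sigma> e * (\<Prod>u\<in>e - {v}. x u))" by simp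
  qed
  also have "sum ?f {e\<in>E. v \<notin> e} = (\<Sum>e\<in>{e\<in>E. v \<notin> e}. \<sigma> e * (\<Prod>u\<in>e. x u))"
    by (intro sum.cong arg_cong2[where f = "(*)"] prod.cong) auto
  finally show ?thesis .
qed

section \<open>Variational description of the minimum \<open>H\<close>-eigenvalue\<close>

text \<open>Vectors are functions on the whole type, hence the condition that they vanish off
  \<open>V\<close>. For even \<open>k\<close> no term of the sum is negative, so every coordinate
  lies in \<open>{-1..1}\<close>; the set is then a closed part of a product of compact
  sets.\<close>

lemma compact_power_sphere:
  assumes "finite V" "even k" "k > 0"
  shows "compact {x :: 'v \<Rightarrow> real. (\<forall>v. v \<notin> V \<longrightarrow> x v = 0) \<and> (\<Sum>v\<in>V. x v ^ k) = 1}"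
proof -
  let ?K = "\<lambda>v. if v \<in> V then {-1..1} else {0 :: real}"
  have "compactin (product_topology (\<lambda>_. euclidean) UNIV) (PiE UNIV ?K)"
    by (subst compactin_PiE) (auto simp: compactin_euclidean_iff)
  then have "compact (PiE UNIV ?K)"
    by (simp add: euclidean_product_topology compactin_euclidean_iff)
  moreover have "closed {x :: 'v \<Rightarrow> real. (\<Sum>v\<in>V. x v ^ k) = 1}"
    by (intro closed_Collect_eq continuous_intros continuous_on_product_coordinates)
  ultimately have "compact (PiE UNIV ?K \<inter> {x. (\<Sum>v\<in>V. x v ^ k) = 1})"
    by (rule compact_Int_closed)
  moreover have "PiE UNIV ?K \<inter> {x. (\<Sum>v\<in>V. x v ^ k) = 1} =
      {x. (\<forall>v. v \<notin> V \<longrightarrow> x v = 0) \<and> (\<Sum>v\<in>V. x v ^ k) = 1}"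
  proof -
    have "\<bar>x v\<bar> \<le> 1" if "(\<Sum>v\<in>V. x v ^ k) = 1" "v \<in> V" for x :: "'v \<Rightarrow> real" and v
    proof -
      have "x v ^ k \<le> (\<Sum>v\<in>V. x v ^ k)"
        by (rule member_le_sum) (use that assms in \<open>auto simp: zero_le_even_power\<close>)
      then have "\<bar>x v\<bar> ^ k \<le> 1" using that assms by (simp add: power_even_abs)
      then show ?thesis using assms(3) by (metis abs_ge_zero power_le_one_iff not_gr_zero)
    qed
    then show ?thesis by (fastforce simp: PiE_UNIV_domain Pi_iff abs_le_iff split: if_splits)
  qed
  ultimately show ?thesis by simp
qed

text \<open>The form attains its minimum on the compact sphere, and homogeneity of degree
  \<open>k\<close> extends the inequality to all vectors. The factor \<open>real k\<close> is the
  one from Euler's identity, so that \<open>\<mu>\<close> is the eigenvalue itself.\<close>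

lemma signed_form_minimum:
  assumes H: "uniform_hypergraph k V E" and "even k" "k > 0" "V \<noteq> {}"
  obtains \<mu> z where "(\<Sum>v\<in>V. z v ^ k) = 1" "real k * signed_form E \<sigma> z = \<mu>"
    "\<And>x. \<mu> * (\<Sum>v\<in>V. x v ^ k) \<le> real k * signed_form E \<sigma> x"
proof -
  note HD = uniform_hypergraphD[OF H]
  define B where "B = {x :: 'a \<Rightarrow> real. (\<forall>v. v \<notin> V \<longrightarrow> x v = 0) \<and> (\<Sum>v\<in>V. x v ^ k) = 1}"
  obtain w where "w \<in> V" using assms(4) by blast
  have "(\<Sum>v\<in>V. (if v = w then 1 else 0 :: real) ^ k) = (\<Sum>v\<in>V. if v = w then 1 else 0)"
    by (intro sum.cong) (use assms in auto)
  then have "(\<lambda>v. if v = w then 1 else 0) \<in> B"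
    using \<open>w \<in> V\<close> HD(1) by (simp add: B_def)
  then have "B \<noteq> {}" by blast
  moreover have "continuous_on B (\<lambda>x. real k * signed_form E \<sigma> x)"
    unfolding signed_form_def
    by (intro continuous_intros continuous_on_subset[OF continuous_on_product_coordinates]) auto
  ultimately obtain z where z: "z \<in> B"
    and min: "\<And>x. x \<in> B \<Longrightarrow> real k * signed_form E \<sigma> z \<le> real k * signed_form E \<sigma> x"
    using continuous_attains_inf[of B] compact_power_sphere[OF HD(1) assms(2,3)]
    unfolding B_def[symmetric] by blast
  define \<mu> where "\<mu> = real k * signed_form E \<sigma> z"
  have "\<mu> * (\<Sum>v\<in>V. x v ^ k) \<le> real k * signed_form E \<sigma> x" for x
  proof -
    let ?N = "\<Sum>v\<in>V. x v ^ k"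
    have nn: "x v ^ k \<ge> 0" for v using assms(2) by (simp add: zero_le_even_power)
    then have N: "?N \<ge> 0" by (intro sum_nonneg) auto
    define c where "c = root k ?N"
    have ck: "c ^ k = ?N" using N assms(3) by (simp add: c_def)
    show ?thesis
    proof (cases "?N = 0")
      case True
      then have "x v = 0" if "v \<in> V" for v
        using that sum_nonneg_eq_0_iff[OF HD(1), of "\<lambda>v. x v ^ k"] nn by simp
      then have "signed_form E \<sigma> x = signed_form E \<sigma> (\<lambda>v. 0 * x v)"
        by (intro signed_form_cong[OF H]) auto
      also have "\<dots> = 0" using signed_form_scale[OF H, of \<sigma> 0 x] assms(3) by simp
      finally show ?thesis using True by simp
    next
      case False
      then have "c \<noteq> 0" using ck assms(3) by (metis power_0_left not_gr_zero)
      \<comment> \<open>Rescaling puts \<open>x\<close> on the sphere; the values off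
        \<open>V\<close> are set to zero only for membership in \<open>B\<close>.\<close>
      let ?y = "\<lambda>v. if v \<in> V then inverse c * x v else 0"
      have "(\<Sum>v\<in>V. ?y v ^ k) = (\<Sum>v\<in>V. inverse ?N * x v ^ k)"
        by (intro sum.cong) (auto simp: power_mult_distrib power_inverse ck)
      also have "\<dots> = 1" using False by (simp flip: sum_distrib_left)
      finally have "?y \<in> B" by (simp add: B_def)
      then have "\<mu> \<le> real k * signed_form E \<sigma> ?y" unfolding \<mu>_def by (rule min)
      also have "signed_form E \<sigma> ?y = signed_form E \<sigma> (\<lambda>v. inverse c * x v)"
        by (intro signed_form_cong[OF H]) auto
      also have "\<dots> = inverse ?N * signed_form E \<sigma> x"
        unfolding signed_form_scale[OF H] power_inverse ck ..
      finally show ?thesis using N False by (simp add: field_simps)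
    qed
  qed
  then show ?thesis using that[of z \<mu>] z \<mu>_def by (simp add: B_def)
qed

text \<open>The minimiser is an eigenvector by the first-order condition in each coordinate.
  Conversely, Euler's identity at an eigenvector for \<open>l\<close> makes
  \<open>real k * signed_form E \<sigma> x\<close> equal to \<open>l\<close> times the power sum, so
  \<open>l\<close> cannot lie below the minimum.\<close>

lemma min_H_eigenvalue_signed_tensor:
  assumes H: "uniform_hypergraph k V E" and "even k" "k > 0" "V \<noteq> {}"
  obtains \<mu> where "min_H_eigenvalue k V (signed_tensor k E \<sigma>) \<mu>"
    "\<And>x. \<mu> * (\<Sum>v\<in>V. x v ^ k) \<le> real k * signed_form E \<sigma> x"
proof -
  note HD = uniform_hypergraphD[OF H]
  obtain \<mu> z where z: "(\<Sum>v\<in>V. z v ^ k) = 1" "real k * signed_form E \<sigma> z = \<mu>"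
    and min: "\<And>x. \<mu> * (\<Sum>v\<in>V. x v ^ k) \<le> real k * signed_form E \<sigma> x"
    by (rule signed_form_minimum[OF assms]) blast
  have "signed_link_form E \<sigma> z v = \<mu> * z v ^ (k - 1)" if v: "v \<in> V" for v
  proof -
    \<comment> \<open>Along each coordinate axis through \<open>z\<close> the function \<open>g\<close> is nonnegative and vanishes at \<open>z\<close>,
      so its derivative there is zero; by homogeneity no Lagrange multiplier is needed.\<close>
    let ?g = "\<lambda>r. real k * signed_form E \<sigma> (z(v := r)) - \<mu> * (\<Sum>u\<in>V. (z(v := r)) u ^ k)"
    let ?c = "real k * (\<Sum>e\<in>{e\<in>E. v \<notin> e}. \<sigma> e * (\<Prod>u\<in>e. z u)) - \<mu> * (\<Sum>u\<in>V - {v}. z u ^ k)"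
    have "(\<Sum>u\<in>V. (z(v := r)) u ^ k) = r ^ k + (\<Sum>u\<in>V - {v}. z u ^ k)" for r
      using sum.remove[OF HD(1) v, of "\<lambda>u. (z(v := r)) u ^ k"] by simp
    then have g: "?g r = real k * (r * signed_link_form E \<sigma> z v) - \<mu> * r ^ k + ?c" for r
      unfolding signed_form_update[OF H] by (simp add: algebra_simps)
    have "(?g has_real_derivative
        (real k * signed_link_form E \<sigma> z v - \<mu> * (real k * z v ^ (k - 1)))) (at (z v))"
      unfolding g by (auto intro!: derivative_eq_intros)
    moreover have "?g (z v) = 0" using z by simp
    then have "\<forall>y. \<bar>z v - y\<bar> < 1 \<longrightarrow> ?g (z v) \<le> ?g y" using min by (metis diff_ge_0_iff_ge)
    ultimately have "real k * signed_link_form E \<sigma> z v - \<mu> * (real k * z v ^ (k - 1)) = 0"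
      using DERIV_local_min[OF _ zero_less_one] by blast
    then have "real k * (signed_link_form E \<sigma> z v - \<mu> * z v ^ (k - 1)) = 0"
      by (simp add: algebra_simps)
    then show ?thesis using assms(3) by simp
  qed
  moreover have "\<exists>v\<in>V. z v \<noteq> 0"
  proof (rule ccontr)
    assume "\<not> ?thesis"
    then have "(\<Sum>v\<in>V. z v ^ k) = 0" using assms(3) by simp
    then show False using z by simp
  qed
  ultimately have eig: "H_eigenvalue k V (signed_tensor k E \<sigma>) \<mu>"
    unfolding H_eigenvalue_signed_tensor[OF H] by blast
  have "\<mu> \<le> l" if l: "H_eigenvalue k V (signed_tensor k E \<sigma>) l" for l
  proof -
    obtain x where x: "\<exists>v\<in>V. x v \<noteq> 0" "\<And>v. v \<in> V \<Longrightarrow> signed_link_form E \<sigma> x v = l * x v ^ (k - 1)"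
      using l[unfolded H_eigenvalue_signed_tensor[OF H]] by (elim exE conjE) simp
    obtain w where w: "w \<in> V" "x w \<noteq> 0" using x(1) by blast
    have "(\<Sum>v\<in>V. x v ^ k) > 0"
      by (rule sum_pos2[OF HD(1) w(1)]) (use w assms in \<open>auto simp: zero_le_even_power zero_less_power_eq\<close>)
    moreover have "\<mu> * (\<Sum>v\<in>V. x v ^ k) \<le> l * (\<Sum>v\<in>V. x v ^ k)"
    proof -
      have "real k * signed_form E \<sigma> x = (\<Sum>v\<in>V. x v * (l * x v ^ (k - 1)))"
        unfolding signed_form_Euler[OF H, symmetric] by (intro sum.cong) (auto simp: x)
      also have "\<dots> = (\<Sum>v\<in>V. l * x v ^ k)"
        by (intro sum.cong refl) (use assms(3) in \<open>simp add: power_eq_if\<close>)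
      finally show ?thesis using min[of x] by (simp add: sum_distrib_left)
    qed
    ultimately show ?thesis by simp
  qed
  then show ?thesis using that[of \<mu>] eig min by (auto simp: min_H_eigenvalue_def)
qed

text \<open>A vector supported on \<open>e\<close> kills every other monomial, because another edge
  of the same size is not contained in \<open>e\<close>. The value at one vertex of \<open>e\<close>
  then decides the sign.\<close>

lemma signed_form_negative:
  assumes H: "uniform_hypergraph k V E" and "k > 0" "e \<in> E" "\<sigma> e \<noteq> 0"
  shows "\<exists>x. signed_form E \<sigma> x < 0"
proof -
  note HD = uniform_hypergraphD[OF H]
  have fe: "finite e" and ce: "card e = k" using HD assms(3) by auto
  obtain w where w: "w \<in> e" using ce assms(2) by fastforce
  \<comment> \<open>The value \<open>- \<sigma> e\<close> at \<open>w\<close> turns the surviving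
    term into minus a square, whatever the sign of \<open>\<sigma> e\<close>.\<close>
  define x where "x = (\<lambda>v. if v \<in> e then if v = w then - \<sigma> e else 1 else (0 :: real))"
  have "\<sigma> f * (\<Prod>u\<in>f. x u) = (if f = e then - (\<sigma> e)\<^sup>2 else 0)" if f: "f \<in> E" for f
  proof (cases "f = e")
    case True
    have "(\<Prod>u\<in>e - {w}. x u) = 1" by (rule prod.neutral) (auto simp: x_def)
    then show ?thesis
      using True prod.remove[OF fe w, of x] w by (simp add: x_def power2_eq_square)
  next
    case False
    then have "\<not> f \<subseteq> e" using card_subset_eq[OF fe, of f] HD(5)[OF f] ce by auto
    then obtain u where "u \<in> f" "u \<notin> e" by blast
    then have "u \<in> f" "x u = 0" by (auto simp: x_def)
    then have "(\<Prod>u\<in>f. x u) = 0" using HD(4)[OF f] by (auto simp: prod_zero_iff)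
    then show ?thesis using False by simp
  qed
  then have "signed_form E \<sigma> x = - (\<sigma> e)\<^sup>2"
    using HD(2) assms(3) by (simp add: signed_form_def)
  then show ?thesis using assms(4) by (metis neg_less_0_iff_less zero_less_power2)
qed

section \<open>Counting with \<open>t\<close>-independent sets\<close>

lemma t_independence_number_attained:
  assumes "finite V"
  obtains S where "t_independent t V E S" "card S = t_independence_number t V E"
proof -
  have "finite {S. t_independent t V E S}"
    by (rule finite_subset[of _ "Pow V"]) (use assms in \<open>auto simp: t_independent_def\<close>)
  moreover have "t_independent t V E {}" by (simp add: t_independent_def)
  ultimately have "Max (card ` {S. t_independent t V E S}) \<in> card ` {S. t_independent t V E S}"
    by (intro Max_in) auto
  then show ?thesis using that by (auto simp: t_independence_number_def)
qed

text \<open>Count the pairs of a vertex of \<open>S\<close> and an edge through it: each vertex is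
  in at least \<open>min_degree V E\<close> edges, and each edge meeting \<open>S\<close> contains
  exactly \<open>t\<close> vertices of \<open>S\<close>.\<close>

lemma min_degree_mult_card_le:
  assumes H: "uniform_hypergraph k V E" and S: "t_independent t V E S"
  shows "real (min_degree V E) * real (card S) \<le> real t * real (card {e\<in>E. e \<inter> S \<noteq> {}})"
proof -
  note HD = uniform_hypergraphD[OF H]
  have SV: "S \<subseteq> V" and Se: "\<And>e. e \<in> E \<Longrightarrow> card (e \<inter> S) \<in> {0, t}"
    using S by (auto simp: t_independent_def)
  then have finS: "finite S" using HD(1) finite_subset by blast
  have "real (min_degree V E) * real (card S) = (\<Sum>v\<in>S. real (min_degree V E))" by simp
  also have "\<dots> \<le> (\<Sum>v\<in>S. real (vertex_degree E v))"
    by (intro sum_mono) (use HD(1) SV in \<open>auto simp: min_degree_def\<close>)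
  also have "\<dots> = (\<Sum>v\<in>S. \<Sum>e\<in>{e\<in>E. v \<in> e}. 1)"
    by (simp add: vertex_degree_def)
  also have "\<dots> = (\<Sum>e\<in>E. \<Sum>v\<in>e \<inter> S. 1)"
    by (rule sum_incidence_swap[OF finS HD(2)])
  also have "\<dots> = (\<Sum>e\<in>E. if e \<inter> S \<noteq> {} then real t else 0)"
  proof (intro sum.cong refl)
    fix e assume e: "e \<in> E"
    show "(\<Sum>v\<in>e \<inter> S. 1) = (if e \<inter> S \<noteq> {} then real t else 0)"
      using Se[OF e] finS by auto
  qed
  also have "\<dots> = (\<Sum>e\<in>{e\<in>E. e \<inter> S \<noteq> {}}. real t)"
    by (rule sum.inter_filter[symmetric]) (rule HD(2))
  finally show ?thesis by (simp add: mult.commute)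
qed

text \<open>The witness \<open>s\<close> maximises \<open>k * d * s ^ t - t * L * s ^ k\<close> over \<open>s \<ge> 0\<close>.\<close>

lemma critical_scale:
  fixes d L :: real
  assumes "0 < t" "t < k" "d \<ge> 0" "L > 0"
  obtains s where "s \<ge> 0" "(real k * d * s ^ t - real t * L * s ^ k) * L powr (real t / (real k - real t)) =
    (real k - real t) * d powr (real k / (real k - real t))"
proof (cases "d = 0")
  case True
  \<comment> \<open>Both sides vanish at \<open>s = 0\<close>: the exponents \<open>t\<close> and
    \<open>k\<close> are positive, and \<open>0 powr p = 0\<close>.\<close>
  then show ?thesis using that[of 0] assms by simp
next
  case False
  then have d: "d > 0" using assms by simp
  define r where "r = real k - real t"
  have r: "r > 0" "real (k - t) = r" using assms by (auto simp: r_def of_nat_diff)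
  \<comment> \<open>The derivative \<open>k * t * (d * s ^ (t - 1) - L * s ^ (k - 1))\<close>
    vanishes for positive \<open>s\<close> exactly when \<open>s ^ (k - t) = d / L\<close>.\<close>
  define s where "s = (d / L) powr (1 / r)"
  have s: "s > 0" using d assms by (simp add: s_def)
  have st: "s ^ t = (d / L) powr (real t / r)"
    using s by (simp add: s_def powr_powr flip: powr_realpow)
  have "s ^ (k - t) = (d / L) powr (real (k - t) / r)"
    using s by (simp add: s_def powr_powr flip: powr_realpow)
  then have "s ^ (k - t) = d / L" using r d assms by simp
  then have sk: "s ^ k = s ^ t * (d / L)"
    using assms by (metis le_add_diff_inverse less_imp_le power_add)
  have "(real k * d * s ^ t - real t * L * s ^ k) * L powr (real t / r) =
      r * (d * (s ^ t * L powr (real t / r)))"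
    using assms by (simp add: sk r_def algebra_simps)
  also have "s ^ t * L powr (real t / r) = d powr (real t / r)"
    using d assms by (simp add: st powr_divide)
  also have "d * d powr (real t / r) = d powr (1 + real t / r)"
    using d by (simp add: powr_add)
  also have "1 + real t / r = real k / r" using r by (simp add: r_def field_simps)
  finally show ?thesis using that[of s] s by (simp add: r_def)
qed

theorem theorem3p5:
  fixes k t n m \<delta> :: nat
    and V :: "'v set"
    and E :: "'v set set"
  assumes "even k" and "even t" and "0 < t" and "t < k"
    and "uniform_hypergraph k V E"
    and "card V = n" and "card E = m" and "m \<ge> 1"
    and "min_degree V E = \<delta>"
  shows "\<exists>A\<in>signed_adjacency_tensors k V E. \<exists>\<mu>::real. min_H_eigenvalue k V A \<mu> \<and>
    real (t_independence_number t V E) \<le>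
      (real t * (real k * real m - real n * \<mu>) * (- \<mu>) powr (real t / (real k - real t))) /
      ((real k - real t) * real \<delta> powr (real k / (real k - real t))
        + (real k * real \<delta> - real t * \<mu>) * (- \<mu>) powr (real t / (real k - real t)))"
proof -
  note H = assms(5)
  note HD = uniform_hypergraphD[OF H]
  have "k > 0" using assms by simp
  obtain e0 where e0: "e0 \<in> E" using assms(7,8) by fastforce
  have "V \<noteq> {}" using HD(3,5)[OF e0] \<open>k > 0\<close> by auto
  obtain S where S: "t_independent t V E S" and cS: "card S = t_independence_number t V E"
    by (rule t_independence_number_attained[OF HD(1)])
  have SV: "S \<subseteq> V" using S by (simp add: t_independent_def)
  define \<sigma> :: "'v set \<Rightarrow> real" where "\<sigma> e = (if e \<inter> S = {} then 1 else -1)" for e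
  obtain \<mu> where \<mu>: "min_H_eigenvalue k V (signed_tensor k E \<sigma>) \<mu>"
    and min: "\<And>x. \<mu> * (\<Sum>v\<in>V. x v ^ k) \<le> real k * signed_form E \<sigma> x"
    by (rule min_H_eigenvalue_signed_tensor[OF H assms(1) \<open>k > 0\<close> \<open>V \<noteq> {}\<close>]) blast
  have "\<mu> < 0"
  proof -
    have "\<sigma> e0 \<noteq> 0" by (simp add: \<sigma>_def)
    then obtain x where "signed_form E \<sigma> x < 0"
      using signed_form_negative[where \<sigma> = \<sigma>, OF H \<open>k > 0\<close> e0] by blast
    then have "real k * signed_form E \<sigma> x < 0" using \<open>k > 0\<close> by (simp add: mult_pos_neg)
    then have "\<mu> * (\<Sum>v\<in>V. x v ^ k) < 0" using min[of x] by linarith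
    moreover have "(\<Sum>v\<in>V. x v ^ k) \<ge> 0"
      using assms(1) by (intro sum_nonneg) (simp add: zero_le_even_power)
    ultimately show ?thesis by (simp add: mult_less_0_iff)
  qed
  define m1 where "m1 = card {e\<in>E. e \<inter> S \<noteq> {}}"
  let ?a = "real (card S)" and ?L = "(- \<mu>) powr (real t / (real k - real t))"
  obtain s where s: "s \<ge> 0" "(real k * real \<delta> * s ^ t - real t * (- \<mu>) * s ^ k) * ?L =
      (real k - real t) * real \<delta> powr (real k / (real k - real t))"
    by (rule critical_scale[of t k "real \<delta>" "- \<mu>"]) (use assms \<open>\<mu> < 0\<close> in auto)
  define x where "x v = (if v \<in> S then s else 1)" for v
  have "(\<Sum>v\<in>V. x v ^ k) = (\<Sum>v\<in>S. x v ^ k) + (\<Sum>v\<in>V - S. x v ^ k)"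
    by (subst add.commute, rule sum.subset_diff) (use SV HD(1) in auto)
  also have "\<dots> = (\<Sum>v\<in>S. s ^ k) + (\<Sum>v\<in>V - S. 1)"
    by (intro arg_cong2[where f = "(+)"] sum.cong) (auto simp: x_def)
  also have "\<dots> = ?a * s ^ k + (real n - ?a)"
  proof -
    have "card (V - S) = n - card S" "card S \<le> n"
      using card_Diff_subset[of S V] card_mono[OF HD(1) SV] SV HD(1) assms(6) finite_subset by auto
    then show ?thesis by (simp add: of_nat_diff)
  qed
  finally have norm: "(\<Sum>v\<in>V. x v ^ k) = ?a * s ^ k + (real n - ?a)" .
  \<comment> \<open>An edge meeting \<open>S\<close> has exactly \<open>t\<close> vertices of value
    \<open>s\<close> and contributes \<open>- s ^ t\<close>; any other edge contributes
    \<open>1\<close>. Only the number \<open>m1\<close> of edges of the first kind enters.\<close>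
  have "signed_form E \<sigma> x = (\<Sum>e\<in>E. 1 - (if e \<inter> S \<noteq> {} then 1 + s ^ t else 0))"
    unfolding signed_form_def
  proof (intro sum.cong refl)
    fix e assume e: "e \<in> E"
    have "(\<Prod>u\<in>e. x u) = (\<Prod>u\<in>e \<inter> S. s)"
      unfolding x_def using HD(4)[OF e] by (simp add: prod.If_cases)
    also have "\<dots> = s ^ (if e \<inter> S = {} then 0 else t)"
    proof -
      have "card (e \<inter> S) = (if e \<inter> S = {} then 0 else t)"
        using S e HD(4)[OF e] unfolding t_independent_def by (auto simp del: card_eq_0_iff simp flip: card_0_eq)
      then show ?thesis by simp
    qed
    finally show "\<sigma> e * (\<Prod>u\<in>e. x u) = 1 - (if e \<inter> S \<noteq> {} then 1 + s ^ t else 0)"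
      by (simp add: \<sigma>_def)
  qed
  also have "\<dots> = real m - real m1 * (1 + s ^ t)"
    using HD(2) assms(7) by (simp add: sum_subtractf m1_def flip: sum.inter_filter)
  finally have "\<mu> * (?a * s ^ k + (real n - ?a)) \<le> real k * (real m - real m1 * (1 + s ^ t))"
    using min[of x] norm by simp
  then have "real t * (\<mu> * (?a * s ^ k + (real n - ?a))) \<le>
      real t * (real k * (real m - real m1 * (1 + s ^ t)))"
    by (intro mult_left_mono) auto
  \<comment> \<open>The number \<open>m1\<close> occurs with factor
    \<open>- real k * real t * (1 + s ^ t)\<close>, so its lower bound in terms of
    \<open>\<delta>\<close> and \<open>card S\<close> eliminates it.\<close>
  moreover have "real k * (1 + s ^ t) * (real \<delta> * ?a) \<le> real k * (1 + s ^ t) * (real t * real m1)"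
    using min_degree_mult_card_le[OF H S] s(1) assms(9) by (intro mult_left_mono) (auto simp: m1_def)
  ultimately have bound: "?a * (real k * real \<delta> * s ^ t - real t * (- \<mu>) * s ^ k + (real k * real \<delta> - real t * \<mu>))
      \<le> real t * (real k * real m - real n * \<mu>)"
    by (simp add: algebra_simps)
  have "?L > 0" using \<open>\<mu> < 0\<close> by simp
  let ?D = "(real k - real t) * real \<delta> powr (real k / (real k - real t))
      + (real k * real \<delta> - real t * \<mu>) * ?L"
  have "real t * \<mu> < 0" using \<open>\<mu> < 0\<close> assms(3) by (simp add: mult_pos_neg)
  moreover have "real k * real \<delta> \<ge> 0" by simp
  ultimately have "real k * real \<delta> - real t * \<mu> > 0" by linarith
  then have "?D > 0"
    using \<open>?L > 0\<close> assms(4) by (intro add_nonneg_pos mult_pos_pos mult_nonneg_nonneg) auto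
  \<comment> \<open>After multiplication by \<open>?L\<close>, the choice of \<open>s\<close> turns
    the part of \<open>bound\<close> that depends on \<open>s\<close> into the first summand of
    \<open>?D\<close>.\<close>
  moreover have "?a * ?D \<le> real t * (real k * real m - real n * \<mu>) * ?L"
    using mult_right_mono[OF bound, of ?L] \<open>?L > 0\<close> unfolding s(2)[symmetric]
    by (simp add: algebra_simps)
  ultimately have "?a \<le> real t * (real k * real m - real n * \<mu>) * ?L / ?D"
    by (simp add: pos_le_divide_eq)
  moreover have "signed_tensor k E \<sigma> \<in> signed_adjacency_tensors k V E"
    by (rule signed_tensor_mem) (simp add: \<sigma>_def)
  ultimately show ?thesis using \<mu> cS by auto
qed

end
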